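(* Let $\mathcal{X}=\{x\in\mathbb{Z}^p\times\mathbb{R}^{n-p} : Ax=b,\ x\in\mathcal{K}\}$, and suppose $\mathcal{X}\neq\emptyset$. Let $\mathcal{D}\supseteq\mathcal{X}$ be a split disjunction, i.e. $$\mathcal{D}=\{x : Ax=b,\ x\in\mathcal{K},\ \pi^Tx\le\pi_0\}\ \cup\ \{x : Ax=b,\ x\in\mathcal{K},\ \pi^Tx\ge\pi_0+1\}.$$ Let $\bar x\in\mathbb{R}^n$ satisfy $A\bar x=b$ and let $\rho\in\operatorname{int}\mathcal{K}$. Then the membership conic problem with uniform normalization associated with this disjunction, $$\min_{y,z,\eta}\ \eta\quad\text{s.t.}\quad y_1+y_2=\bar x,\quad z_1+z_2=1,\quad Ay_h=z_hb\ (h=1,2),\quad (y_h+\eta\rho,z_h)\in\mathcal{K}\times\mathbb{R}_+\ (h=1,2),\quad -\pi^Ty_1\ge -z_1\pi_0,\quad \pi^Ty_2\ge z_2(\pi_0+1),\quad \eta\ge 0,$$ is strongly feasible.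
   Context: Setting: $A\in\mathbb{R}^{m\times n}$, $b\in\mathbb{R}^m$, $0\le p\le n$, and $\mathcal{K}\subseteq\mathbb{R}^n$ is a proper cone (closed, convex, pointed, with non-empty interior); $\pi\in\mathbb{R}^n$, $\pi_0\in\mathbb{R}$. The point $\bar x$ need not belong to $\mathcal{K}$. Strong feasibility: a system of linear equalities and conic constraints, each cone being written as a Cartesian product of cones, is strongly feasible if it has a solution that satisfies all constraints and for which, moreover, every conic constraint corresponding to a non-polyhedral factor cone is satisfied strictly (i.e. the constrained vector lies in the interior of that factor). A problem is strongly feasible if its constraint system is. *)

theory Defs
  imports "HOL-Analysis.Analysis"
begin

definition proper_cone :: "'a::euclidean_space set \<Rightarrow> bool" where
  "proper_cone K \<longleftrightarrow>
     convex_cone K \<and> closed K \<and> (\<forall>x. x \<in> K \<and> - x \<in> K \<longrightarrow> x = 0) \<and> interior K \<noteq> {}"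

text \<open>
  Cartesian product representations of cones. A factor is a pair \<open>(B, C)\<close>, where \<open>B\<close> is a block of
  coordinates (a set of standard basis vectors) and \<open>C\<close> is a cone in the coordinate subspace
  \<open>span B\<close>. The blocks partition the basis of the ambient space, and the product of the factors
  consists of the vectors whose projection to every block lies in the corresponding cone.
\<close>

definition coord_proj :: "'a::euclidean_space set \<Rightarrow> 'a \<Rightarrow> 'a" where
  "coord_proj B w = (\<Sum>b\<in>B. (w \<bullet> b) *\<^sub>R b)"

definition factor_product :: "('a::euclidean_space set \<times> 'a set) set \<Rightarrow> 'a set" where
  "factor_product F = {w. \<forall>(B, C)\<in>F. coord_proj B w \<in> C}"

definition cone_factorization ::
    "'a::euclidean_space set \<Rightarrow> ('a set \<times> 'a set) set \<Rightarrow> bool" where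
  "cone_factorization K F \<longleftrightarrow>
     partition_on Basis (fst ` F) \<and> inj_on fst F \<and>
     (\<forall>(B, C)\<in>F. C \<subseteq> span B \<and> convex_cone C) \<and>
     K = factor_product F"

definition single_factor :: "'a::euclidean_space set \<Rightarrow> ('a set \<times> 'a set) set" where
  "single_factor K = {(Basis, K)}"

definition prod_factors ::
    "('a::euclidean_space set \<times> 'a set) set \<Rightarrow> ('b::euclidean_space set \<times> 'b set) set \<Rightarrow>
     (('a \<times> 'b) set \<times> ('a \<times> 'b) set) set"  (infixr \<open>\<otimes>\<^sub>F\<close> 80) where
  "F \<otimes>\<^sub>F G =
     (\<lambda>(B, C). ((\<lambda>x. (x, 0)) ` B, (\<lambda>x. (x, 0)) ` C)) ` F \<union>
     (\<lambda>(B, C). ((\<lambda>x. (0, x)) ` B, (\<lambda>x. (0, x)) ` C)) ` G"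

text \<open>
  The problem of minimising \<open>objective v\<close> subject to \<open>eq_map v = eq_rhs\<close> and \<open>conic_map v\<close> being in
  the product of the \<open>factors\<close>.
\<close>

record ('v, 'e, 'w) conic_problem =
  objective :: "'v \<Rightarrow> real"
  eq_map :: "'v \<Rightarrow> 'e"
  eq_rhs :: 'e
  conic_map :: "'v \<Rightarrow> 'w"
  factors :: "('w set \<times> 'w set) set"

definition feasible_set :: "('v, 'e, 'w::euclidean_space) conic_problem \<Rightarrow> 'v set" where
  "feasible_set P = {v. eq_map P v = eq_rhs P \<and> conic_map P v \<in> factor_product (factors P)}"

text \<open>
  The interior of a factor is taken in the coordinate subspace in which the factor lives.
\<close>

definition strongly_feasible :: "('v, 'e, 'w::euclidean_space) conic_problem \<Rightarrow> bool" where
  "strongly_feasible P \<longleftrightarrow>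
     (\<exists>v\<in>feasible_set P. \<forall>(B, C)\<in>factors P.
        \<not> polyhedron C \<longrightarrow>
        coord_proj B (conic_map P v) \<in> (top_of_set (span B)) interior_of C)"

definition mixed_integer_set ::
    "real^('n::{finite,linorder})^'m \<Rightarrow> real^'m \<Rightarrow>
     (real^('n::{finite,linorder})) set \<Rightarrow> nat \<Rightarrow> (real^('n::{finite,linorder})) set" where
  "mixed_integer_set A b K p =
     {x. (\<forall>i. card {j. j < i} < p \<longrightarrow> x $ i \<in> \<int>) \<and> A *v x = b \<and> x \<in> K}"

definition split_disjunction ::
    "real^'n^'m \<Rightarrow> real^'m \<Rightarrow> (real^'n) set \<Rightarrow> real^'n \<Rightarrow> real \<Rightarrow> (real^'n) set" where
  "split_disjunction A b K \<pi> \<pi>0 =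
     {x. A *v x = b \<and> x \<in> K \<and> \<pi> \<bullet> x \<le> \<pi>0} \<union>
     {x. A *v x = b \<and> x \<in> K \<and> \<pi> \<bullet> x \<ge> \<pi>0 + 1}"

text \<open>
  The variables are \<open>((y1, y2), (z1, z2), \<eta>)\<close>. The argument \<open>F\<close> is the chosen representation of \<open>K\<close>
  as a Cartesian product; the scalar inequalities are constraints with cone \<open>{0..}\<close>.
\<close>

definition membership_problem ::
    "real^'n^'m \<Rightarrow> real^'m \<Rightarrow> ((real^'n) set \<times> (real^'n) set) set \<Rightarrow>
     real^'n \<Rightarrow> real \<Rightarrow> real^'n \<Rightarrow> real^'n \<Rightarrow>
     (((real^'n) \<times> (real^'n)) \<times> (real \<times> real) \<times> real,
      (real^'n) \<times> real \<times> (real^'m) \<times> (real^'m),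
      ((real^'n) \<times> real) \<times> ((real^'n) \<times> real) \<times> real \<times> real \<times> real) conic_problem" where
  "membership_problem A b F \<pi> \<pi>0 xbar \<rho> =
    \<lparr> objective = (\<lambda>((y1, y2), (z1, z2), \<eta>). \<eta>),
      eq_map = (\<lambda>((y1, y2), (z1, z2), \<eta>).
        (y1 + y2, z1 + z2, A *v y1 - z1 *\<^sub>R b, A *v y2 - z2 *\<^sub>R b)),
      eq_rhs = (xbar, 1, 0, 0),
      conic_map = (\<lambda>((y1, y2), (z1, z2), \<eta>).
        ((y1 + \<eta> *\<^sub>R \<rho>, z1), (y2 + \<eta> *\<^sub>R \<rho>, z2),
         - (\<pi> \<bullet> y1) - (- z1 * \<pi>0), \<pi> \<bullet> y2 - z2 * (\<pi>0 + 1), \<eta>)),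
      factors =
        (F \<otimes>\<^sub>F single_factor {0..}) \<otimes>\<^sub>F (F \<otimes>\<^sub>F single_factor {0..}) \<otimes>\<^sub>F
        single_factor {0..} \<otimes>\<^sub>F single_factor {0..} \<otimes>\<^sub>F single_factor {0..} \<rparr>"

lemma coord_proj_Basis [simp]: "coord_proj Basis w = w"
  by (simp add: coord_proj_def euclidean_representation)

lemma factor_product_single [simp]: "factor_product (single_factor K) = K"
  by (simp add: factor_product_def single_factor_def)

lemma cone_factorization_single:
  fixes K :: "'a::euclidean_space set"
  assumes "convex_cone K"
  shows "cone_factorization K (single_factor K)"
proof -
  have "{} \<noteq> (Basis :: 'a set)"
    using nonempty_Basis by metis
  with assms show ?thesis
    unfolding cone_factorization_def factor_product_single
    by (simp add: single_factor_def partition_on_def)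
qed

lemma coord_proj_fst: "coord_proj ((\<lambda>x. (x, 0)) ` B) (x, y) = (coord_proj B x, 0)"
  unfolding coord_proj_def
  by (subst sum.reindex) (auto simp: inj_on_def inner_prod_def sum_prod)

lemma coord_proj_snd: "coord_proj ((\<lambda>y. (0, y)) ` B) (x, y) = (0, coord_proj B y)"
  unfolding coord_proj_def
  by (subst sum.reindex) (auto simp: inj_on_def inner_prod_def sum_prod)

lemma factor_product_prod [simp]:
  "factor_product (F \<otimes>\<^sub>F G) = factor_product F \<times> factor_product G"
  unfolding factor_product_def prod_factors_def ball_Un ball_simps
  by (auto simp: coord_proj_fst coord_proj_snd image_iff case_prod_beta)

lemma cone_factorization_prod:
  assumes "cone_factorization K F" "cone_factorization L G"
  shows "cone_factorization (K \<times> L) (F \<otimes>\<^sub>F G)"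
proof -
  let ?l = "\<lambda>x::'a. (x, 0::'b)" and ?r = "\<lambda>y::'b. (0::'a, y)"
  have lin: "linear ?l" "linear ?r"
    by (auto intro!: linearI)
  have inj: "inj ?l" "inj ?r"
    by (auto intro: injI)
  have pF: "partition_on Basis (fst ` F)" and pG: "partition_on Basis (fst ` G)"
    using assms by (auto simp: cone_factorization_def)
  have nz: "0 \<notin> B" if "B \<in> fst ` F" for B
    using pF that nonzero_Basis unfolding partition_on_def by blast
  have ne: "{} \<notin> fst ` F" "{} \<notin> fst ` G"
    using pF pG by (auto simp: partition_on_def)
  have img: "fst ` (F \<otimes>\<^sub>F G) = (image ?l) ` fst ` F \<union> (image ?r) ` fst ` G"
    unfolding prod_factors_def image_Un image_image by (simp add: case_prod_beta)
  have part: "partition_on Basis (fst ` (F \<otimes>\<^sub>F G))"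
    unfolding partition_on_def img
  proof (intro conjI)
    have un: "\<Union> (image ?l ` fst ` F) = ?l ` Basis" "\<Union> (image ?r ` fst ` G) = ?r ` Basis"
      using pF pG by (simp_all only: partition_on_def image_Union [symmetric])
    show "\<Union> (image ?l ` fst ` F \<union> image ?r ` fst ` G) = Basis"
      by (simp only: Union_Un_distrib un Basis_prod_def)
    have disjF: "disjoint (image ?l ` fst ` F)"
      using pF inj(1) by (meson disjoint_image inj_on_subset partition_on_def subset_UNIV)
    have disjG: "disjoint (image ?r ` fst ` G)"
      using pG inj(2) by (meson disjoint_image inj_on_subset partition_on_def subset_UNIV)
    have "?l ` Basis \<inter> ?r ` Basis = {}"
      using nonzero_Basis by auto
    then show "disjoint (image ?l ` fst ` F \<union> image ?r ` fst ` G)"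
      using disjF disjG by (intro disjoint_union) (simp_all only: un)
    show "{} \<notin> image ?l ` fst ` F \<union> image ?r ` fst ` G"
      using ne by blast
  qed
  have injF: "inj_on fst F" and injG: "inj_on fst G"
    using assms by (auto simp: cone_factorization_def)
  have cross: "?l ` B \<noteq> ?r ` B'" if B: "B \<in> fst ` F" and B': "B' \<in> fst ` G" for B B'
  proof
    assume eq: "?l ` B = ?r ` B'"
    obtain x where "x \<in> B"
      using B ne by (metis all_not_in_conv)
    then have "(x, 0) \<in> ?r ` B'"
      using eq by blast
    then show False
      using nz[OF B] \<open>x \<in> B\<close> by auto
  qed
  have injP: "inj_on fst (F \<otimes>\<^sub>F G)"
  proof (rule inj_onI)
    fix u v assume u: "u \<in> F \<otimes>\<^sub>F G" and v: "v \<in> F \<otimes>\<^sub>F G" and e: "fst u = fst v"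
    have c: "w \<in> F \<otimes>\<^sub>F G \<Longrightarrow>
        (\<exists>B C. (B, C) \<in> F \<and> w = (?l ` B, ?l ` C)) \<or> (\<exists>B C. (B, C) \<in> G \<and> w = (?r ` B, ?r ` C))" for w
      unfolding prod_factors_def by auto
    have F: "(B, C) \<in> F \<Longrightarrow> (B, C') \<in> F \<Longrightarrow> C = C'" for B C C'
      using injF unfolding inj_on_def by fastforce
    have G: "(B, C) \<in> G \<Longrightarrow> (B, C') \<in> G \<Longrightarrow> C = C'" for B C C'
      using injG unfolding inj_on_def by fastforce
    have mF: "(B, C) \<in> F \<Longrightarrow> B \<in> fst ` F" and mG: "(B', C') \<in> G \<Longrightarrow> B' \<in> fst ` G" for B C B' C'
      by force+
    show "u = v"
      using c[OF u] c[OF v]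
    proof (elim disjE exE conjE)
      fix B C B' C' assume "(B, C) \<in> F" "u = (?l ` B, ?l ` C)" "(B', C') \<in> F" "v = (?l ` B', ?l ` C')"
      with e F inj(1) show "u = v"
        by (metis fst_conv inj_image_eq_iff)
    next
      fix B C B' C' assume "(B, C) \<in> G" "u = (?r ` B, ?r ` C)" "(B', C') \<in> G" "v = (?r ` B', ?r ` C')"
      with e G inj(2) show "u = v"
        by (metis fst_conv inj_image_eq_iff)
    next
      fix B C B' C' assume "(B, C) \<in> F" "u = (?l ` B, ?l ` C)" "(B', C') \<in> G" "v = (?r ` B', ?r ` C')"
      with e cross[OF mF mG] show "u = v"
        by (metis fst_conv)
    next
      fix B C B' C' assume "(B, C) \<in> G" "u = (?r ` B, ?r ` C)" "(B', C') \<in> F" "v = (?l ` B', ?l ` C')"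
      with e cross[OF mF mG] show "u = v"
        by (metis fst_conv)
    qed
  qed
  have conesF: "\<forall>(B, C)\<in>F. C \<subseteq> span B \<and> convex_cone C"
    and conesG: "\<forall>(B, C)\<in>G. C \<subseteq> span B \<and> convex_cone C"
    using assms by (auto simp: cone_factorization_def)
  have cones: "C \<subseteq> span B \<and> convex_cone C" if "(B, C) \<in> F \<otimes>\<^sub>F G" for B C
  proof -
    from that consider
        B' C' where "(B', C') \<in> F" "B = ?l ` B'" "C = ?l ` C'"
      | B' C' where "(B', C') \<in> G" "B = ?r ` B'" "C = ?r ` C'"
      unfolding prod_factors_def by auto
    then show ?thesis
    proof cases
      case 1
      then have "C' \<subseteq> span B'" "convex_cone C'"
        using conesF by auto
      then show ?thesis
        using 1 lin(1) by (simp add: linear_span_image image_mono convex_cone_linear_image)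
    next
      case 2
      then have "C' \<subseteq> span B'" "convex_cone C'"
        using conesG by auto
      then show ?thesis
        using 2 lin(2) by (simp add: linear_span_image image_mono convex_cone_linear_image)
    qed
  qed
  show ?thesis
    unfolding cone_factorization_def
    using part injP cones assms by (auto simp: cone_factorization_def)
qed

lemma cone_factorization_membership_problem:
  assumes "cone_factorization K F"
  shows "cone_factorization
           ((K \<times> {0..}) \<times> (K \<times> {0..}) \<times> {0..} \<times> {0..} \<times> {0..})
           (factors (membership_problem A b F \<pi> \<pi>0 xbar \<rho>))"
proof -
  have "convex_cone {0::real..}"
    by (auto simp: convex_cone_def conic_def)
  then show ?thesis
    using assms
    by (simp add: membership_problem_def cone_factorization_prod cone_factorization_single)
qed

lemma feasible_set_membership_problem:
  assumes "cone_factorization K F"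
  shows "((y1, y2), (z1, z2), \<eta>) \<in> feasible_set (membership_problem A b F \<pi> \<pi>0 xbar \<rho>) \<longleftrightarrow>
    y1 + y2 = xbar \<and> z1 + z2 = 1 \<and> A *v y1 = z1 *\<^sub>R b \<and> A *v y2 = z2 *\<^sub>R b \<and>
    (y1 + \<eta> *\<^sub>R \<rho>, z1) \<in> K \<times> {0..} \<and> (y2 + \<eta> *\<^sub>R \<rho>, z2) \<in> K \<times> {0..} \<and>
    - (\<pi> \<bullet> y1) \<ge> - z1 * \<pi>0 \<and> \<pi> \<bullet> y2 \<ge> z2 * (\<pi>0 + 1) \<and> \<eta> \<ge> 0"
  using assms by (auto simp: feasible_set_def membership_problem_def cone_factorization_def)

end

theory Submission
  imports Defs
begin

text \<open>
  Every \<open>(y1, y2)\<close> becomes strictly conic feasible once \<open>\<eta>\<close> is large, and scalar factors are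
  polyhedral, so only the linear constraints matter. Take a point \<open>x0\<close> of the disjunction, say
  with \<open>\<pi> \<bullet> x0 \<le> \<pi>0\<close>, and put all the weight on that side, \<open>z = (1, 0)\<close>. If
  \<open>\<pi> \<bullet> xbar \<le> \<pi>0\<close> then \<open>y = (xbar, 0)\<close> works; otherwise \<open>\<pi> \<bullet> xbar > \<pi> \<bullet> x0\<close>, and
  \<open>y = (x0, xbar - x0)\<close> works. The other side is symmetric.
\<close>

text \<open>The second half of strong feasibility, stated for a factor family and a vector instead
  of a problem, so that it can be established factor by factor along
  \<open>\<otimes>\<^sub>F\<close>.\<close>

definition strictly_satisfies ::
    "('a::euclidean_space set \<times> 'a set) set \<Rightarrow> 'a \<Rightarrow> bool" where
  "strictly_satisfies F w \<longleftrightarrow>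
     (\<forall>(B, C)\<in>F. \<not> polyhedron C \<longrightarrow> coord_proj B w \<in> (top_of_set (span B)) interior_of C)"

lemma strongly_feasibleI:
  assumes "v \<in> feasible_set P" "strictly_satisfies (factors P) (conic_map P v)"
  shows "strongly_feasible P"
  using assms unfolding strongly_feasible_def strictly_satisfies_def by blast

lemma strictly_satisfies_atLeast: "strictly_satisfies (single_factor {c::real..}) x"
  using polyhedron_halfspace_ge[of c "1::real"]
  by (simp add: strictly_satisfies_def single_factor_def atLeast_def)

lemma polyhedron_linear_vimage:
  fixes f :: "'a::euclidean_space \<Rightarrow> 'b::euclidean_space"
  assumes f: "linear f" and S: "polyhedron S"
  shows "polyhedron (f -` S)"
proof -
  obtain H where H: "finite H" "S = \<Inter>H" "\<forall>h\<in>H. \<exists>a b. a \<noteq> 0 \<and> h = {x. a \<bullet> x \<le> b}"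
    using S unfolding polyhedron_def by blast
  have "polyhedron (f -` h)" if h: "h \<in> H" for h
  proof -
    obtain a b where "h = {x. a \<bullet> x \<le> b}"
      using H(3) h by blast
    then have "f -` h = {x. adjoint f a \<bullet> x \<le> b}"
      unfolding adjoint_clauses(2)[OF f] by blast
    \<comment> \<open>\<open>adjoint f a\<close> may be 0; the preimage is then empty or everything,
      which \<open>polyhedron_halfspace_le\<close> also covers.\<close>
    then show ?thesis
      by (simp add: polyhedron_halfspace_le)
  qed
  then have "polyhedron (\<Inter> (vimage f ` H))"
    using H(1) by (intro polyhedron_Inter finite_imageI) blast+
  moreover have "f -` S = \<Inter> (vimage f ` H)"
    unfolding H(2) by blast
  ultimately show ?thesis
    by simp
qed

text \<open>With a left inverse \<open>g\<close> of \<open>f\<close>, the image is the subspace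
  \<open>range f\<close> cut by the preimage of \<open>S\<close> under \<open>g\<close>. The
  contrapositive serves later: if an embedded factor is not polyhedral, neither is the original
  one.\<close>

lemma polyhedron_injective_linear_image:
  fixes f :: "'a::euclidean_space \<Rightarrow> 'b::euclidean_space"
  assumes f: "linear f" "inj f" and S: "polyhedron S"
  shows "polyhedron (f ` S)"
proof -
  obtain g where g: "linear g" "g \<circ> f = id"
    using linear_injective_left_inverse[OF f] by blast
  have gf: "g (f x) = x" for x
    using g(2) by (metis comp_apply id_apply)
  have "subspace (range f)"
    using f(1) subspace_UNIV by (rule linear_subspace_image)
  then have "polyhedron (range f)"
    by (intro affine_imp_polyhedron subspace_imp_affine)
  moreover have "f ` S = range f \<inter> g -` S"
    by (auto simp: gf)
  ultimately show ?thesis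
    using polyhedron_linear_vimage[OF g(1) S] by simp
qed

lemma interior_of_span_injective_linear_image:
  fixes f :: "'a::euclidean_space \<Rightarrow> 'b::euclidean_space"
  assumes f: "linear f" "inj f" and w: "w \<in> (top_of_set (span B)) interior_of C"
  shows "f w \<in> (top_of_set (span (f ` B))) interior_of (f ` C)"
proof -
  obtain g where g: "linear g" "g \<circ> f = id"
    using linear_injective_left_inverse[OF f] by blast
  have gf: "g (f x) = x" for x
    using g(2) by (metis comp_apply id_apply)
  obtain T where T: "open T" "w \<in> span B \<inter> T" "span B \<inter> T \<subseteq> C"
    using w by (auto simp: interior_of_def openin_open)
  have "open (g -` T)"
    using T(1) linear_continuous_on g(1) linear_conv_bounded_linear open_vimage by blast
  \<comment> \<open>The open set that witnesses relative openness of the image is the preimage of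
    \<open>T\<close> under the left inverse.\<close>
  moreover have "f ` (span B \<inter> T) = span (f ` B) \<inter> g -` T"
    unfolding linear_span_image[OF f(1)] by (auto simp: gf)
  ultimately have "openin (top_of_set (span (f ` B))) (f ` (span B \<inter> T))"
    unfolding openin_open by blast
  with T show ?thesis
    unfolding interior_of_def by blast
qed

text \<open>Each factor of the product is a coordinate embedding of a factor of \<open>F\<close> or
  \<open>G\<close>. Non-polyhedrality is pulled back along the embedding, and relative interiority
  is pushed forward.\<close>

lemma strictly_satisfies_prod:
  fixes F :: "('a::euclidean_space set \<times> 'a set) set"
    and G :: "('b::euclidean_space set \<times> 'b set) set"
  assumes F: "strictly_satisfies F x" and G: "strictly_satisfies G y"
  shows "strictly_satisfies (F \<otimes>\<^sub>F G) (x, y)"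
proof -
  have lin: "linear (\<lambda>x::'a. (x, 0::'b))" "linear (\<lambda>y::'b. (0::'a, y))"
    by (auto intro!: linearI)
  have inj: "inj (\<lambda>x::'a. (x, 0::'b))" "inj (\<lambda>y::'b. (0::'a, y))"
    by (auto intro: injI)
  have "coord_proj B (x, y) \<in> (top_of_set (span B)) interior_of C"
    if "(B, C) \<in> F \<otimes>\<^sub>F G" and np: "\<not> polyhedron C" for B C
  proof -
    from that(1) consider
        B' C' where "(B', C') \<in> F" "B = (\<lambda>x. (x, 0)) ` B'" "C = (\<lambda>x. (x, 0)) ` C'"
      | B' C' where "(B', C') \<in> G" "B = (\<lambda>y. (0, y)) ` B'" "C = (\<lambda>y. (0, y)) ` C'"
      unfolding prod_factors_def by auto
    then show ?thesis
    proof cases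
      case 1
      then have "\<not> polyhedron C'"
        using np polyhedron_injective_linear_image[OF lin(1) inj(1)] by blast
      then have "coord_proj B' x \<in> (top_of_set (span B')) interior_of C'"
        using F 1(1) by (auto simp: strictly_satisfies_def)
      then show ?thesis
        using interior_of_span_injective_linear_image[OF lin(1) inj(1)] 1(2,3)
        by (simp add: coord_proj_fst)
    next
      case 2
      then have "\<not> polyhedron C'"
        using np polyhedron_injective_linear_image[OF lin(2) inj(2)] by blast
      then have "coord_proj B' y \<in> (top_of_set (span B')) interior_of C'"
        using G 2(1) by (auto simp: strictly_satisfies_def)
      then show ?thesis
        using interior_of_span_injective_linear_image[OF lin(2) inj(2)] 2(2,3)
        by (simp add: coord_proj_snd)
    qed
  qed
  then show ?thesis
    unfolding strictly_satisfies_def by blast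
qed

lemma coord_proj_in_span: "coord_proj B w \<in> span B"
  unfolding coord_proj_def by (intro span_sum span_scale span_base)

lemma linear_coord_proj: "linear (coord_proj B)"
  by (rule linearI)
    (simp_all add: coord_proj_def inner_left_distrib scaleR_left_distrib sum.distrib scaleR_sum_right)

lemma coord_proj_span:
  assumes B: "B \<subseteq> Basis" and u: "u \<in> span B"
  shows "coord_proj B u = u"
proof -
  have "coord_proj B c = c" if "c \<in> B" for c
  proof -
    have fin: "finite B"
      using B finite_Basis finite_subset by blast
    have "coord_proj B c = (\<Sum>b\<in>B. if b = c then b else 0)"
      unfolding coord_proj_def using B that by (intro sum.cong) (auto simp: inner_Basis subset_iff)
    then show ?thesis
      using fin that by simp
  qed
  then show ?thesis
    using linear_eq_on[OF linear_coord_proj linear_id] u by (metis id_apply)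
qed

text \<open>Moving \<open>w\<close> only inside the block \<open>B\<close> keeps it in \<open>K\<close>, so its projection is interior to \<open>C\<close>.\<close>

lemma strictly_satisfies_interior:
  assumes K: "cone_factorization K F" and w: "w \<in> interior K"
  shows "strictly_satisfies F w"
proof -
  have "coord_proj B w \<in> (top_of_set (span B)) interior_of C" if BC: "(B, C) \<in> F" for B C
  proof -
    have "B \<subseteq> Basis"
      using K BC unfolding cone_factorization_def partition_on_def by force
    obtain e where e: "e > 0" "ball w e \<subseteq> K"
      using w by (auto simp: mem_interior)
    have "u \<in> C" if u: "u \<in> span B" "u \<in> ball (coord_proj B w) e" for u
    proof -
      have "w + (u - coord_proj B w) \<in> ball w e"
        using u(2) by (simp add: dist_norm norm_minus_commute)
      then have "w + (u - coord_proj B w) \<in> K"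
        using e(2) by blast
      then have "coord_proj B (w + (u - coord_proj B w)) \<in> C"
        using K BC by (auto simp: cone_factorization_def factor_product_def)
      moreover have "coord_proj B (w + (u - coord_proj B w)) = u"
        using coord_proj_span[OF \<open>B \<subseteq> Basis\<close> u(1)]
          coord_proj_span[OF \<open>B \<subseteq> Basis\<close> coord_proj_in_span]
        by (simp add: linear_add[OF linear_coord_proj] linear_diff[OF linear_coord_proj])
      ultimately show ?thesis
        by simp
    qed
    moreover have "coord_proj B w \<in> span B \<inter> ball (coord_proj B w) e"
      using e(1) coord_proj_in_span by auto
    moreover have "openin (top_of_set (span B)) (span B \<inter> ball (coord_proj B w) e)"
      by (simp add: openin_open_Int)
    ultimately show ?thesis
      unfolding interior_of_def by blast
  qed
  then show ?thesis
    unfolding strictly_satisfies_def by blast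
qed

text \<open>Scaling a ball around \<rho> inside \<open>K\<close> by \<eta> gives a ball around
  \<open>\<eta> *\<^sub>R \<rho>\<close> inside \<open>K\<close>, whose radius grows with \<eta>
  until it exceeds the norms of both shifts.\<close>

lemma convex_cone_shift_interior:
  fixes K :: "'a::euclidean_space set"
  assumes K: "convex_cone K" and \<rho>: "\<rho> \<in> interior K"
  obtains \<eta> where "\<eta> > 0" "y1 + \<eta> *\<^sub>R \<rho> \<in> interior K" "y2 + \<eta> *\<^sub>R \<rho> \<in> interior K"
proof -
  obtain e where e: "e > 0" "ball \<rho> e \<subseteq> K"
    using \<rho> by (auto simp: mem_interior)
  \<comment> \<open>The sum of the norms serves both vectors at once; the added 1 makes the bound
    strict and keeps \<eta> positive when both vectors vanish.\<close>
  define \<eta> where "\<eta> = (norm y1 + norm y2 + 1) / e"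
  have pos: "\<eta> > 0"
    using e(1) unfolding \<eta>_def by (intro divide_pos_pos add_nonneg_pos) auto
  have \<eta>: "norm y1 + norm y2 < e * \<eta>"
    using e(1) by (simp add: \<eta>_def)
  have "(*\<^sub>R) \<eta> ` ball \<rho> e \<subseteq> K"
    using K e(2) pos by (auto simp: convex_cone_def conic_def)
  then have "ball (\<eta> *\<^sub>R \<rho>) (e * \<eta>) \<subseteq> interior K"
    using pos by (intro interior_maximal) (simp_all add: ball_scale mult.commute)
  moreover have "y1 + \<eta> *\<^sub>R \<rho> \<in> ball (\<eta> *\<^sub>R \<rho>) (e * \<eta>)" "y2 + \<eta> *\<^sub>R \<rho> \<in> ball (\<eta> *\<^sub>R \<rho>) (e * \<eta>)"
    using \<eta> norm_ge_zero[of y1] norm_ge_zero[of y2] by (simp_all add: dist_norm del: norm_ge_zero)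
  ultimately show ?thesis
    using that pos by blast
qed

lemma strongly_feasible_membership_problem:
  fixes A :: "real^'n^'m" and F :: "((real^'n) set \<times> (real^'n) set) set"
  assumes K: "convex_cone K" "cone_factorization K F" and \<rho>: "\<rho> \<in> interior K"
    and y: "y1 + y2 = xbar" "A *v y1 = z1 *\<^sub>R b" "A *v y2 = z2 *\<^sub>R b"
    and z: "z1 + z2 = 1" "z1 \<ge> 0" "z2 \<ge> 0"
    and split: "\<pi> \<bullet> y1 \<le> z1 * \<pi>0" "\<pi> \<bullet> y2 \<ge> z2 * (\<pi>0 + 1)"
  shows "strongly_feasible (membership_problem A b F \<pi> \<pi>0 xbar \<rho>)"
proof -
  obtain \<eta> where \<eta>: "\<eta> > 0" "y1 + \<eta> *\<^sub>R \<rho> \<in> interior K" "y2 + \<eta> *\<^sub>R \<rho> \<in> interior K"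
    using convex_cone_shift_interior[OF K(1) \<rho>] .
  show ?thesis
  proof (rule strongly_feasibleI)
    show "((y1, y2), (z1, z2), \<eta>) \<in> feasible_set (membership_problem A b F \<pi> \<pi>0 xbar \<rho>)"
      unfolding feasible_set_membership_problem[OF K(2)]
      using y z split \<eta> interior_subset by auto
    show "strictly_satisfies (factors (membership_problem A b F \<pi> \<pi>0 xbar \<rho>))
        (conic_map (membership_problem A b F \<pi> \<pi>0 xbar \<rho>) ((y1, y2), (z1, z2), \<eta>))"
      \<comment> \<open>The half-lines are polyhedral, so a weight \<open>z1\<close> or
        \<open>z2\<close> equal to 0 and tight split inequalities are harmless; only the two copies
        of \<open>F\<close> need interior points.\<close>
      using \<eta>(2,3) K(2)
      by (simp add: membership_problem_def strictly_satisfies_prod strictly_satisfies_atLeast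
          strictly_satisfies_interior)
  qed
qed

theorem theorem10:
  fixes A :: "real^('n::{finite,linorder})^'m" and b :: "real^'m"
    and K :: "(real^('n::{finite,linorder})) set"
    and F :: "((real^('n::{finite,linorder})) set \<times> (real^('n::{finite,linorder})) set) set"
    and p :: nat and \<pi> xbar \<rho> :: "real^('n::{finite,linorder})" and \<pi>0 :: real
  assumes "p \<le> CARD('n)"
    and "proper_cone K"
    and "cone_factorization K F"
    and "mixed_integer_set A b K p \<noteq> {}"
    and "mixed_integer_set A b K p \<subseteq> split_disjunction A b K \<pi> \<pi>0"
    and "A *v xbar = b"
    and "\<rho> \<in> interior K"
  shows "strongly_feasible (membership_problem A b F \<pi> \<pi>0 xbar \<rho>)"
proof -
  have "convex_cone K"
    using assms(2) by (simp add: proper_cone_def)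
  note sf = strongly_feasible_membership_problem[OF this assms(3) assms(7)]
  obtain x0 where "x0 \<in> split_disjunction A b K \<pi> \<pi>0"
    using assms(4,5) by blast
  then have x0: "A *v x0 = b" and "\<pi> \<bullet> x0 \<le> \<pi>0 \<or> \<pi> \<bullet> x0 \<ge> \<pi>0 + 1"
    by (auto simp: split_disjunction_def)
  \<comment> \<open>If \<open>xbar\<close> lies strictly between the two half-spaces,
    \<open>x0\<close> lies beyond it on one side, which gives the comparison in the last two
    cases.\<close>
  then consider "\<pi> \<bullet> xbar \<le> \<pi>0" | "\<pi> \<bullet> xbar \<ge> \<pi>0 + 1"
    | "\<pi> \<bullet> x0 \<le> \<pi>0" "\<pi> \<bullet> x0 \<le> \<pi> \<bullet> xbar" | "\<pi> \<bullet> x0 \<ge> \<pi>0 + 1" "\<pi> \<bullet> xbar \<le> \<pi> \<bullet> x0"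
    by linarith
  then show ?thesis
  proof cases
    case 1
    then show ?thesis
      using assms(6) by (intro sf[where ?y1.0 = xbar and ?y2.0 = 0 and ?z1.0 = 1 and ?z2.0 = 0]) auto
  next
    case 2
    then show ?thesis
      using assms(6) by (intro sf[where ?y1.0 = 0 and ?y2.0 = xbar and ?z1.0 = 0 and ?z2.0 = 1]) auto
  next
    case 3
    \<comment> \<open>With \<open>z2 = 0\<close> the constraints on \<open>y2\<close> are
      homogeneous: \<open>xbar - x0\<close> lies in the kernel of \<open>A\<close> and has
      nonnegative inner product with \<pi>.\<close>
    then show ?thesis
      using assms(6) x0
      by (intro sf[where ?y1.0 = x0 and ?y2.0 = "xbar - x0" and ?z1.0 = 1 and ?z2.0 = 0])
        (auto simp: matrix_vector_mult_diff_distrib inner_diff_right)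
  next
    case 4
    then show ?thesis
      using assms(6) x0
      by (intro sf[where ?y1.0 = "xbar - x0" and ?y2.0 = x0 and ?z1.0 = 0 and ?z2.0 = 1])
        (auto simp: matrix_vector_mult_diff_distrib inner_diff_right)
  qed
qed

end
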